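(* Let $G$ and $H$ be arithmetical functions on the monic polynomials of $A=\mathbb{F}_q[X]$, and for monic $h,f\in A$ put $$S(h;f)=\sum_{d\mid (h,f)} G(d)\,H(f/d).$$ For monic $f\in A$ and any $g\in A$ define $$a_f(g)=\frac{1}{|f|}\sum_{d\mid (f,g)}|d|\,H(d)\,G\left(\frac{f}{d}\right).$$ Then for all monic $h,f\in A$, $$S(h;f)=\sum_{g \bmod f}a_f(g)\,\varepsilon(hg,f),$$ where the sum extends over any complete residue system modulo $f$ and $\varepsilon$ is the additive character defined in the context. Moreover, if $G$ is completely multiplicative and $r=(g,f)$, then $$a_f(g)=\frac{1}{|f|}\,G\left(\frac{f}{r}\right)\sum_{d\mid r}|d|\,H(d)\,G\left(\frac{r}{d}\right).$$
   Context: $A=\mathbb{F}_q[X]$ is the polynomial ring over the finite field with $q=p^t$ elements, $p$ prime, $t\ge 1$. An arithmetical function is a complex-valued function on the set of monic polynomials in $A$; $G$ is completely multiplicative if $G(1)=1$ and $G(fg)=G(f)G(g)$ for all monic $f,g$. For nonzero $f\in A$, $|f|=q^{\deg f}$. $(a,b)$ denotes the monic greatest common divisor (so $(f,0)=f$ for monic $f$), and sums over $d\mid n$ run over the monic divisors $d$ of $n$. Definition of $\varepsilon$: let $f\in A$ be monic of degree $r$ and let $h\in A$. Write $h\equiv \alpha_1X^{r-1}+\dots+\alpha_r \pmod f$ with $\alpha_i\in\mathbb{F}_q$, i.e. $\alpha_1$ is the coefficient of $X^{r-1}$ in the remainder of $h$ modulo $f$ (if $r=0$ the remainder is $0$ and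 $\alpha_1=0$). If $t=1$, so $q=p$, put $\varepsilon(h,f)=\exp(2\pi i\alpha_1/p)$. If $t>1$, fix a presentation $\mathbb{F}_q=\mathbb{F}_p(\theta)$ where $\theta$ is a root of an irreducible polynomial $\Psi(X)=X^t+c_1X^{t-1}+\dots+c_t\in\mathbb{F}_p[X]$; write $\alpha_1=a_1\theta^{t-1}+\dots+a_t$ with $a_i\in\mathbb{F}_p$, and put $\varepsilon(h,f)=\exp(2\pi i a_1/p)$. (Elements of $\mathbb{F}_p$ are represented by integers in the exponent.) $\varepsilon(h,f)$ depends only on $h$ modulo $f$. *)

theory Defs
  imports
    Complex_Main
    "HOL-Library.Cardinality"
    "HOL-Computational_Algebra.Computational_Algebra"
    "HOL-Number_Theory.Cong"
begin

text \<open>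
  The ring \<open>A = F\<^sub>q[X]\<close> is \<^typ>\<open>'a poly\<close> for \<open>'a\<close> of sort \<open>{finite_field, field_gcd}\<close>. The class
  \<open>field_gcd\<close> is what the library needs to provide \<^const>\<open>gcd\<close> on \<^typ>\<open>'a poly\<close>. It does not restrict
  the field: on a field the class axioms force \<open>gcd\<close>, \<open>normalize\<close> and \<open>unit_factor\<close> to be
  the trivial ones. The resulting \<^const>\<open>gcd\<close> on \<^typ>\<open>'a poly\<close> is the monic one (or \<open>0\<close>).

  Arithmetical functions are total functions \<open>'a poly \<Rightarrow> complex\<close>, but they are only ever evaluated
  at monic polynomials, so their values elsewhere are irrelevant.
\<close>

definition monic_divisors :: "'a :: field poly \<Rightarrow> 'a poly set" where
  "monic_divisors n = {d. lead_coeff d = 1 \<and> d dvd n}"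

text \<open>The absolute value \<open>|f| = q ^ deg f\<close>; only meaningful for \<open>f \<noteq> 0\<close>.\<close>
definition poly_abs :: "'a :: {field, finite} poly \<Rightarrow> nat" where
  "poly_abs f = CARD('a) ^ degree f"

definition completely_multiplicative :: "('a :: field poly \<Rightarrow> complex) \<Rightarrow> bool" where
  "completely_multiplicative G \<longleftrightarrow> G 1 = 1 \<and>
     (\<forall>f g. lead_coeff f = 1 \<longrightarrow> lead_coeff g = 1 \<longrightarrow> G (f * g) = G f * G g)"

definition S_sum :: "('a :: field_gcd poly \<Rightarrow> complex) \<Rightarrow> ('a poly \<Rightarrow> complex) \<Rightarrow>
    'a poly \<Rightarrow> 'a poly \<Rightarrow> complex" where
  "S_sum G H h f = (\<Sum>d\<in>monic_divisors (gcd h f). G d * H (f div d))"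

definition a_coeff :: "('a :: {finite_field, field_gcd} poly \<Rightarrow> complex) \<Rightarrow> ('a poly \<Rightarrow> complex) \<Rightarrow>
    'a poly \<Rightarrow> 'a poly \<Rightarrow> complex" where
  "a_coeff G H f g = 1 / of_nat (poly_abs f) *
     (\<Sum>d\<in>monic_divisors (gcd f g). of_nat (poly_abs d) * H d * G (f div d))"

definition complete_residue_system :: "'a :: field poly \<Rightarrow> 'a poly set \<Rightarrow> bool" where
  "complete_residue_system f R \<longleftrightarrow> (\<forall>g. \<exists>!r. r \<in> R \<and> [r = g] (mod f))"

text \<open>The prime field \<open>F\<^sub>p\<close>, as the image of the integers in \<open>F\<^sub>q\<close>.\<close>
definition prime_field :: "'a :: field set" where
  "prime_field = range of_int"

text \<open>The polynomials of \<open>F\<^sub>p[X]\<close>, viewed inside \<open>F\<^sub>q[X]\<close>.\<close>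
definition prime_field_polys :: "'a :: field poly set" where
  "prime_field_polys = {P. \<forall>i. coeff P i \<in> prime_field}"

text \<open>
  Irreducibility in the ring \<open>F\<^sub>p[X]\<close>, i.e. \<^const>\<open>irreducible\<close> relativised to \<^const>\<open>prime_field_polys\<close>
  (for \<open>t > 1\<close> a \<open>\<Psi>\<close> as below is reducible over \<open>F\<^sub>q\<close>). An element of \<open>F\<^sub>p[X]\<close> is a unit there iff
  it is a unit of \<open>F\<^sub>q[X]\<close>, both meaning a nonzero constant.
\<close>
definition irreducible_over_prime_field :: "'a :: field poly \<Rightarrow> bool" where
  "irreducible_over_prime_field P \<longleftrightarrow> P \<in> prime_field_polys \<and> P \<noteq> 0 \<and> \<not> P dvd 1 \<and>
     (\<forall>Q \<in> prime_field_polys. \<forall>R \<in> prime_field_polys. P = Q * R \<longrightarrow> Q dvd 1 \<or> R dvd 1)"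

text \<open>
  \<open>F\<^sub>q = F\<^sub>p(\<theta>)\<close> with \<open>\<theta>\<close> a root of the monic irreducible \<open>\<Psi> \<in> F\<^sub>p[X]\<close> of degree \<open>t\<close>. When
  \<open>q = p ^ t\<close>, the equality \<open>F\<^sub>q = F\<^sub>p(\<theta>)\<close> is automatic, by counting elements.
\<close>
definition presentation :: "nat \<Rightarrow> 'a :: field \<Rightarrow> 'a poly \<Rightarrow> bool" where
  "presentation t \<theta> \<Psi> \<longleftrightarrow> lead_coeff \<Psi> = 1 \<and> degree \<Psi> = t \<and>
     irreducible_over_prime_field \<Psi> \<and> poly \<Psi> \<theta> = 0"

text \<open>The coordinate \<open>a\<^sub>1\<close> in \<open>\<alpha> = a\<^sub>1 \<theta>\<^bsup>t-1\<^esup> + \<dots> + a\<^sub>t\<close> with \<open>a\<^sub>i \<in> F\<^sub>p\<close>.\<close>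
definition first_coord :: "nat \<Rightarrow> 'a :: field \<Rightarrow> 'a \<Rightarrow> 'a" where
  "first_coord t \<theta> \<alpha> = (THE x. \<exists>a. (\<forall>i\<in>{1..t}. a i \<in> prime_field) \<and>
     \<alpha> = (\<Sum>i=1..t. a i * \<theta> ^ (t - i)) \<and> x = a 1)"

definition prime_field_rep :: "nat \<Rightarrow> 'a :: field \<Rightarrow> nat" where
  "prime_field_rep p x = (THE n. n < p \<and> of_nat n = x)"

text \<open>
  \<open>\<alpha>\<^sub>1\<close>, the coefficient of \<open>X\<^bsup>r-1\<^esup>\<close> in \<open>h mod f\<close> where \<open>r = deg f\<close>. For monic \<open>f\<close> with \<open>r = 0\<close> we
  have \<open>f = 1\<close> and \<open>h mod f = 0\<close>, so the truncated \<open>r - 1\<close> correctly yields \<open>0\<close>.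
\<close>
definition top_residue_coeff :: "'a :: field poly \<Rightarrow> 'a poly \<Rightarrow> 'a" where
  "top_residue_coeff h f = coeff (h mod f) (degree f - 1)"

definition epsilon :: "nat \<Rightarrow> nat \<Rightarrow> 'a :: field \<Rightarrow> 'a poly \<Rightarrow> 'a poly \<Rightarrow> complex" where
  "epsilon p t \<theta> h f =
     (let \<alpha> = top_residue_coeff h f;
          x = (if t = 1 then \<alpha> else first_coord t \<theta> \<alpha>)
      in exp (2 * of_real pi * \<i> * of_nat (prime_field_rep p x) / of_nat p))"

end

theory Submission
  imports Defs
begin

text \<open>
  The identity is a discrete Fourier expansion on \<open>A / f\<close>. By definition \<open>\<epsilon>(h, f)\<close> is a function
  \<open>\<chi>\<close> of the top coefficient of \<open>h mod f\<close>, and two properties of it suffice: \<open>\<chi>\<close> is an additive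
  character of \<open>F\<^sub>q\<close>, and it is nontrivial (\<open>epsilon_character\<close>). This is where, for
  \<open>t > 1\<close>, the presentation enters. The powers \<open>\<theta>\<^bsup>t-1\<^esup>, \<dots>, 1\<close> are linearly independent over \<open>F\<^sub>p\<close> because \<open>\<Psi>\<close> is irreducible
  there (\<open>presentation_minimal\<close>), and by counting they form a basis, so the first coordinate is
  a well-defined additive map onto \<open>F\<^sub>p\<close>.

  Now insert the definition of \<open>a\<^sub>f(g)\<close> and exchange the sums. Each monic \<open>d\<close> dividing \<open>f\<close> then carries
  the sum of \<open>\<epsilon>(h g, f)\<close> over the multiples \<open>g = d k\<close> of \<open>d\<close>, with \<open>k\<close> modulo \<open>f / d\<close>. In \<open>k\<close> the summand
  is a character, so its sum is \<open>|f / d|\<close> if the character is trivial and \<open>0\<close> otherwise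
  (\<open>sum_character_mod\<close>). Triviality means that \<open>f\<close> divides \<open>h d\<close>: a nonzero remainder can
  be multiplied so as to have any prescribed top coefficient (\<open>top_residue_coeff_surj\<close>). So exactly the
  \<open>d\<close> with \<open>f / d\<close> dividing \<open>h\<close> survive, the factor \<open>|d| |f / d|\<close> cancels \<open>1 / |f|\<close>, and replacing \<open>d\<close>
  by \<open>f / d\<close> gives \<open>S(h; f)\<close>.

  The second formula follows from \<open>f / d = (f / r) (r / d)\<close> for \<open>d\<close> dividing \<open>r\<close>.
\<close>

section \<open>The prime field and polynomials over it\<close>

lemma prime_field_0 [simp]: "0 \<in> prime_field"
  and prime_field_1 [simp]: "1 \<in> prime_field"
  unfolding prime_field_def by (metis of_int_0 rangeI, metis of_int_1 rangeI)

lemma prime_field_add: "x \<in> prime_field \<Longrightarrow> y \<in> prime_field \<Longrightarrow> x + y \<in> prime_field"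
  by (auto simp: prime_field_def simp flip: of_int_add)

lemma prime_field_diff: "x \<in> prime_field \<Longrightarrow> y \<in> prime_field \<Longrightarrow> x - y \<in> prime_field"
  by (auto simp: prime_field_def simp flip: of_int_diff)

lemma prime_field_mult: "x \<in> prime_field \<Longrightarrow> y \<in> prime_field \<Longrightarrow> x * y \<in> prime_field"
  by (auto simp: prime_field_def simp flip: of_int_mult)

lemma prime_field_sum: "(\<And>i. i \<in> I \<Longrightarrow> g i \<in> prime_field) \<Longrightarrow> sum g I \<in> prime_field"
  by (induction I rule: infinite_finite_induct) (auto intro: prime_field_add)

text \<open>Multiplication by a nonzero element is an injection of the finite prime field into itself,
  hence it hits every element.\<close>
lemma prime_field_divide:
  fixes x y :: "'a :: finite_field"
  assumes "x \<in> prime_field" "y \<in> prime_field" "y \<noteq> 0"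
  shows "x / y \<in> prime_field"
proof -
  have "(*) y ` prime_field = prime_field"
    using assms by (intro endo_inj_surj) (auto simp: inj_on_def intro: prime_field_mult)
  then obtain z where "z \<in> prime_field" "x = y * z"
    using assms(1) by blast
  then show ?thesis using assms(3) by simp
qed

lemma prime_field_rep:
  fixes x :: "'a :: finite_field"
  assumes "CHAR('a) = p" "x \<in> prime_field"
  shows "prime_field_rep p x < p \<and> of_nat (prime_field_rep p x) = x"
proof -
  have p: "p > 0" using assms(1) by auto
  obtain k where k: "x = of_int k" using assms(2) unfolding prime_field_def by blast
  have "of_nat (nat (k mod int p)) = (of_int (k mod int p) :: 'a)"
    using p by (metis of_int_of_nat_eq nat_0_le pos_mod_sign of_nat_0_less_iff)
  also have "\<dots> = x"
    unfolding k using assms(1) by (simp add: of_int_eq_iff_cong_CHAR cong_def)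
  finally have ex: "of_nat (nat (k mod int p)) = x" .
  have lt: "nat (k mod int p) < p" using p by (simp add: nat_less_iff)
  have "\<exists>!n. n < p \<and> of_nat n = x"
  proof (rule ex1I[of _ "nat (k mod int p)"])
    fix n assume n: "n < p \<and> of_nat n = x"
    then have "[n = nat (k mod int p)] (mod CHAR('a))"
      using ex of_nat_eq_iff_cong_CHAR[where 'a='a] by metis
    then show "n = nat (k mod int p)"
      using n lt assms(1) by (simp add: cong_def)
  qed (use ex lt in auto)
  then show ?thesis unfolding prime_field_rep_def by (rule theI')
qed

text \<open>The translation \<open>x \<mapsto> x + 1\<close> permutes the ring, so it does not change the sum of all elements.\<close>
lemma CHAR_dvd_card_UNIV: "CHAR('a :: {finite, comm_ring_1}) dvd CARD('a)"
proof -
  have "(\<Sum>x\<in>UNIV. x) = (\<Sum>x\<in>UNIV. x + 1 :: 'a)"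
    by (rule sum.reindex_bij_witness[where i = "\<lambda>x. x + 1" and j = "\<lambda>x. x - 1"]) auto
  then have "of_nat CARD('a) = (0 :: 'a)" by (simp add: sum.distrib)
  then show ?thesis by (simp add: of_nat_eq_0_iff_char_dvd)
qed

lemma card_prime_field: "card (prime_field :: 'a :: finite_field set) = CHAR('a)"
proof -
  have "bij_betw of_nat {..<CHAR('a)} (prime_field :: 'a set)"
  proof (rule bij_betwI[where g = "prime_field_rep CHAR('a)"])
    show "of_nat \<in> {..<CHAR('a)} \<rightarrow> (prime_field :: 'a set)"
      unfolding prime_field_def by (metis Pi_I of_int_of_nat_eq rangeI)
    show "prime_field_rep CHAR('a) \<in> (prime_field :: 'a set) \<rightarrow> {..<CHAR('a)}"
      using prime_field_rep by blast
    fix n assume n: "n \<in> {..<CHAR('a)}"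
    have "(of_nat n :: 'a) \<in> prime_field"
      unfolding prime_field_def by (metis of_int_of_nat_eq rangeI)
    note rep = prime_field_rep[OF refl this]
    then have "[prime_field_rep CHAR('a) (of_nat n :: 'a) = n] (mod CHAR('a))"
      using of_nat_eq_iff_cong_CHAR[where 'a='a] by metis
    then show "prime_field_rep CHAR('a) (of_nat n :: 'a) = n"
      using rep n by (simp add: cong_def)
  qed (use prime_field_rep in blast)
  then show ?thesis using bij_betw_same_card by fastforce
qed

lemma prime_field_polys_diff:
  "P \<in> prime_field_polys \<Longrightarrow> Q \<in> prime_field_polys \<Longrightarrow> P - Q \<in> prime_field_polys"
  by (auto simp: prime_field_polys_def intro: prime_field_diff)

lemma prime_field_polys_add:
  "P \<in> prime_field_polys \<Longrightarrow> Q \<in> prime_field_polys \<Longrightarrow> P + Q \<in> prime_field_polys"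
  by (auto simp: prime_field_polys_def intro: prime_field_add)

lemma prime_field_polys_mult:
  "P \<in> prime_field_polys \<Longrightarrow> Q \<in> prime_field_polys \<Longrightarrow> P * Q \<in> prime_field_polys"
  by (auto simp: prime_field_polys_def coeff_mult intro!: prime_field_sum prime_field_mult)

lemma prime_field_polys_monom: "c \<in> prime_field \<Longrightarrow> monom c n \<in> prime_field_polys"
  by (auto simp: prime_field_polys_def)

text \<open>Long division only ever divides by the leading coefficient of the divisor, so it does not leave
  \<open>F\<^sub>p[X]\<close>.\<close>
lemma prime_field_polys_division:
  fixes F Q :: "'a :: finite_field poly"
  assumes "F \<in> prime_field_polys" "Q \<in> prime_field_polys" "Q \<noteq> 0"
  obtains S R where "S \<in> prime_field_polys" "R \<in> prime_field_polys" "F = Q * S + R"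
    "R = 0 \<or> degree R < degree Q"
proof -
  have *: "\<exists>S\<in>prime_field_polys. \<exists>R\<in>prime_field_polys. F = Q * S + R \<and> (R = 0 \<or> degree R < degree Q)"
    if "\<forall>i\<ge>n. coeff F i = 0" "F \<in> prime_field_polys" for n F
    using that
  proof (induction n arbitrary: F)
    case 0
    then have "F = 0" by (simp add: poly_eq_iff)
    then show ?case using 0 by (intro bexI[of _ 0]) auto
  next
    case (Suc n)
    show ?case
    proof (cases "n < degree Q")
      case True
      have "degree F \<le> n" using Suc.prems(1) by (intro degree_le) auto
      with True have "degree F < degree Q" by simp
      then show ?thesis
        using Suc.prems(2) prime_field_polys_monom[of 0 0] by (intro bexI[of _ 0] bexI[of _ F]) auto
    next
      case False
      define T where "T = monom (coeff F n / lead_coeff Q) (n - degree Q)"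
      have T: "T \<in> prime_field_polys"
        unfolding T_def using Suc.prems(2) assms
        by (intro prime_field_polys_monom prime_field_divide) (auto simp: prime_field_polys_def)
      have "coeff (F - Q * T) i = 0" if "i \<ge> n" for i
      proof (cases "i = n")
        case True
        then show ?thesis
          using False assms(3) by (simp add: T_def mult.commute[of Q] coeff_monom_mult)
      next
        case False
        with \<open>\<not> n < degree Q\<close> that have "i - (n - degree Q) > degree Q" "i > n" by linarith+
        then show ?thesis
          using Suc.prems(1) by (simp add: T_def mult.commute[of Q] coeff_monom_mult coeff_eq_0)
      qed
      moreover have "F - Q * T \<in> prime_field_polys"
        using Suc.prems(2) assms(2) T by (intro prime_field_polys_diff prime_field_polys_mult)
      ultimately have "\<exists>S\<in>prime_field_polys. \<exists>R\<in>prime_field_polys.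
          F - Q * T = Q * S + R \<and> (R = 0 \<or> degree R < degree Q)"
        using Suc.IH[of "F - Q * T"] by blast
      then obtain S R where SR: "S \<in> prime_field_polys" "R \<in> prime_field_polys"
          "F - Q * T = Q * S + R" "R = 0 \<or> degree R < degree Q" by blast
      have "F = Q * (S + T) + R" using SR(3) by (simp add: algebra_simps)
      moreover have "S + T \<in> prime_field_polys" using SR(1) T by (rule prime_field_polys_add)
      ultimately show ?thesis using SR(2,4) by blast
    qed
  qed
  have "\<forall>i\<ge>Suc (degree F). coeff F i = 0" by (simp add: coeff_eq_0)
  from *[OF this assms(1)] that show ?thesis by blast
qed

section \<open>Coordinates with respect to the powers of a generator\<close>

text \<open>A nonzero \<open>Q \<in> F\<^sub>p[X]\<close> of least degree with root \<open>\<theta>\<close> divides \<open>\<Psi>\<close> over \<open>F\<^sub>p\<close>, because the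
  remainder also has root \<open>\<theta>\<close>; by irreducibility \<open>Q\<close> has the same degree as \<open>\<Psi>\<close>.\<close>
lemma presentation_minimal:
  fixes \<Psi> P :: "'a :: finite_field poly"
  assumes "presentation t \<theta> \<Psi>" "P \<in> prime_field_polys" "poly P \<theta> = 0" "degree P < t"
  shows "P = 0"
proof (rule ccontr)
  assume "P \<noteq> 0"
  define B where "B = (\<lambda>Q. Q \<in> prime_field_polys \<and> Q \<noteq> 0 \<and> poly Q \<theta> = 0)"
  have "B P" using assms \<open>P \<noteq> 0\<close> by (simp add: B_def)
  from ex_has_least_nat[of B, OF this, of degree]
  obtain Q where Q: "B Q" "\<And>Q'. B Q' \<Longrightarrow> degree Q \<le> degree Q'" by blast
  have \<Psi>: "degree \<Psi> = t" "irreducible_over_prime_field \<Psi>" "poly \<Psi> \<theta> = 0" "\<Psi> \<noteq> 0"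
    using assms(1) by (auto simp: presentation_def)
  have "\<Psi> \<in> prime_field_polys" using \<Psi>(2) by (simp add: irreducible_over_prime_field_def)
  with Q(1) obtain S R where SR: "S \<in> prime_field_polys" "R \<in> prime_field_polys" "\<Psi> = Q * S + R"
    "R = 0 \<or> degree R < degree Q"
    using prime_field_polys_division B_def by metis
  have "poly R \<theta> = 0" using SR(3) \<Psi>(3) Q(1) by (simp add: B_def)
  then have "R = 0" using SR(2,4) Q(2)[of R] unfolding B_def by (metis linorder_not_less)
  then have eq: "\<Psi> = Q * S" using SR by simp
  then have "Q dvd 1 \<or> S dvd 1"
    using \<Psi>(2) Q(1) SR(1) by (auto simp: irreducible_over_prime_field_def B_def)
  moreover have "\<not> Q dvd 1"
    using Q(1) by (auto simp: B_def elim!: is_unit_polyE)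
  moreover have "\<not> S dvd 1"
  proof
    assume "S dvd 1"
    then have "degree S = 0" by (auto elim!: is_unit_polyE)
    then have "degree \<Psi> = degree Q" using eq \<Psi>(4) by (simp add: degree_mult_eq)
    then show False using Q(2)[OF \<open>B P\<close>] assms(4) \<Psi>(1) by simp
  qed
  ultimately show False by blast
qed

text \<open>The difference of two expansions is the value at \<open>\<theta>\<close> of a polynomial over \<open>F\<^sub>p\<close> of degree below
  \<open>t\<close>, which must vanish.\<close>
lemma power_expansion_unique:
  fixes \<Psi> :: "'a :: finite_field poly"
  assumes "presentation t \<theta> \<Psi>" "t \<ge> 1"
    and "\<forall>i\<in>{1..t}. a i \<in> prime_field" "\<forall>i\<in>{1..t}. b i \<in> prime_field"
    and "(\<Sum>i=1..t. a i * \<theta> ^ (t - i)) = (\<Sum>i=1..t. b i * \<theta> ^ (t - i))"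
    and "j \<in> {1..t}"
  shows "a j = b j"
proof -
  define P where "P = (\<Sum>i=1..t. monom (a i - b i) (t - i))"
  have coeffP: "coeff P k = (\<Sum>i=1..t. if t - i = k then a i - b i else 0)" for k
    unfolding P_def by (simp add: coeff_sum)
  have "P = 0"
  proof (rule presentation_minimal[OF assms(1)])
    show "P \<in> prime_field_polys"
      unfolding prime_field_polys_def mem_Collect_eq coeffP
      using assms(3,4) by (auto intro!: prime_field_sum prime_field_diff)
    show "poly P \<theta> = 0"
      using assms(5) by (simp add: P_def poly_sum poly_monom left_diff_distrib sum_subtractf)
    have "degree P \<le> t - 1"
      unfolding P_def by (intro degree_sum_le order.trans[OF degree_monom_le]) auto
    then show "degree P < t" using assms(2) by simp
  qed
  then have "0 = coeff P (t - j)" by simp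
  also have "\<dots> = (\<Sum>i=1..t. if i = j then a i - b i else 0)"
    unfolding coeffP using assms(6) by (intro sum.cong) auto
  also have "\<dots> = a j - b j" using assms(6) by simp
  finally show ?thesis by simp
qed

text \<open>There are \<open>p\<^bsup>t\<^esup>\<close> coordinate vectors and as many field elements, so uniqueness of the
  expansion gives its existence.\<close>
lemma power_expansion_exists:
  fixes \<Psi> :: "'a :: finite_field poly"
  assumes "presentation t \<theta> \<Psi>" "t \<ge> 1" "CARD('a) = CHAR('a) ^ t"
  shows "\<exists>a. (\<forall>i\<in>{1..t}. a i \<in> prime_field) \<and> \<alpha> = (\<Sum>i=1..t. a i * \<theta> ^ (t - i))"
proof -
  define V where "V = (PiE {1..t} (\<lambda>_. prime_field :: 'a set))"
  define e where "e = (\<lambda>a. \<Sum>i=1..t. a i * \<theta> ^ (t - i))"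
  have "inj_on e V"
  proof (rule inj_onI)
    fix a b assume ab: "a \<in> V" "b \<in> V" "e a = e b"
    then have "\<forall>i\<in>{1..t}. a i \<in> prime_field" "\<forall>i\<in>{1..t}. b i \<in> prime_field"
      unfolding V_def by auto
    then have "a j = b j" if "j \<in> {1..t}" for j
      using power_expansion_unique[OF assms(1,2)] ab(3) that unfolding e_def by blast
    with ab show "a = b" unfolding V_def by (blast intro: PiE_ext)
  qed
  then have "card (e ` V) = card V" by (rule card_image)
  also have "\<dots> = CARD('a)" by (simp add: V_def card_PiE card_prime_field assms(3))
  finally have "e ` V = UNIV" by (intro card_subset_eq) auto
  then obtain a where "a \<in> V" "e a = \<alpha>" by (metis UNIV_I imageE)
  then show ?thesis unfolding V_def e_def by (intro exI[of _ a]) auto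
qed

lemma first_coord_sum:
  fixes \<Psi> :: "'a :: finite_field poly"
  assumes "presentation t \<theta> \<Psi>" "t \<ge> 1" "\<forall>i\<in>{1..t}. a i \<in> prime_field"
  shows "first_coord t \<theta> (\<Sum>i=1..t. a i * \<theta> ^ (t - i)) = a 1"
  unfolding first_coord_def
proof (rule the_equality)
  fix x
  assume "\<exists>b. (\<forall>i\<in>{1..t}. b i \<in> prime_field) \<and>
    (\<Sum>i=1..t. a i * \<theta> ^ (t - i)) = (\<Sum>i=1..t. b i * \<theta> ^ (t - i)) \<and> x = b 1"
  then obtain b where b: "\<forall>i\<in>{1..t}. b i \<in> prime_field" "x = b 1"
    "(\<Sum>i=1..t. a i * \<theta> ^ (t - i)) = (\<Sum>i=1..t. b i * \<theta> ^ (t - i))" by blast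
  have "a 1 = b 1"
    by (rule power_expansion_unique[OF assms(1,2,3) b(1,3)]) (use assms(2) in auto)
  then show "x = a 1" using b(2) by simp
qed (use assms(3) in blast)

text \<open>The value at \<open>\<theta>\<^bsup>t-1\<^esup>\<close> later witnesses that the character is not trivial.\<close>
lemma first_coord_additive:
  fixes \<Psi> :: "'a :: finite_field poly"
  assumes "presentation t \<theta> \<Psi>" "t \<ge> 1" "CARD('a) = CHAR('a) ^ t"
  shows first_coord_in_prime_field: "first_coord t \<theta> x \<in> prime_field"
    and first_coord_add: "first_coord t \<theta> (x + y) = first_coord t \<theta> x + first_coord t \<theta> y"
    and first_coord_top_power: "first_coord t \<theta> (\<theta> ^ (t - 1)) = 1"
proof -
  obtain a where a: "\<forall>i\<in>{1..t}. a i \<in> prime_field" "x = (\<Sum>i=1..t. a i * \<theta> ^ (t - i))"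
    using power_expansion_exists[OF assms] by blast
  obtain b where b: "\<forall>i\<in>{1..t}. b i \<in> prime_field" "y = (\<Sum>i=1..t. b i * \<theta> ^ (t - i))"
    using power_expansion_exists[OF assms] by blast
  have x: "first_coord t \<theta> x = a 1" and y: "first_coord t \<theta> y = b 1"
    unfolding a(2) b(2) using first_coord_sum[OF assms(1,2)] a(1) b(1) by blast+
  show "first_coord t \<theta> x \<in> prime_field" using x a(1) assms(2) by simp
  have "x + y = (\<Sum>i=1..t. (a i + b i) * \<theta> ^ (t - i))"
    by (simp add: a(2) b(2) distrib_right sum.distrib)
  then show "first_coord t \<theta> (x + y) = first_coord t \<theta> x + first_coord t \<theta> y"
    using first_coord_sum[OF assms(1,2), of "\<lambda>i. a i + b i"] a(1) b(1) x y
    by (simp add: prime_field_add)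
  have "(\<Sum>i=1..t. (if i = 1 then 1 else 0) * \<theta> ^ (t - i)) = (\<Sum>i=1..t. if i = 1 then \<theta> ^ (t - i) else 0)"
    by (intro sum.cong) auto
  also have "\<dots> = \<theta> ^ (t - 1)" using assms(2) by simp
  finally show "first_coord t \<theta> (\<theta> ^ (t - 1)) = 1"
    using first_coord_sum[OF assms(1,2), of "\<lambda>i. if i = 1 then 1 else 0"] by simp
qed

section \<open>The additive character\<close>

text \<open>The representatives of \<open>x\<close> and \<open>y\<close> add up to that of \<open>x + y\<close> only modulo \<open>p\<close>; a multiple of \<open>p\<close>
  changes the exponent by a multiple of \<open>2 \<pi> \<i>\<close>.\<close>
lemma exp_prime_field_rep_add:
  fixes x y :: "'a :: finite_field"
  assumes "CHAR('a) = p" "x \<in> prime_field" "y \<in> prime_field"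
  defines "E \<equiv> \<lambda>x. exp (2 * of_real pi * \<i> * of_nat (prime_field_rep p x) / of_nat p)"
  shows "E (x + y) = E x * E y"
proof -
  let ?r = "prime_field_rep p"
  have p: "p > 0" using assms(1) by auto
  have "(of_nat (?r x + ?r y) :: 'a) = of_nat (?r (x + y))"
    using prime_field_rep[OF assms(1)] assms(2,3) prime_field_add[OF assms(2,3)] by simp
  then have "[?r x + ?r y = ?r (x + y)] (mod p)"
    using of_nat_eq_iff_cong_CHAR[where 'a='a] assms(1) by blast
  then have "[int (?r x + ?r y) = int (?r (x + y))] (mod int p)"
    by (simp only: cong_int_iff)
  then obtain k where "int (?r x + ?r y) = int (?r (x + y)) + int p * k"
    by (metis cong_iff_lin cong_sym)
  then have k: "real (?r x) + real (?r y) = real (?r (x + y)) + real p * of_int k"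
    by (metis of_int_add of_int_mult of_int_of_nat_eq of_nat_add)
  have E: "E z = cis (2 * pi * real (?r z) / real p)" for z
    by (simp add: E_def cis_conv_exp mult_ac)
  have "E x * E y = cis (2 * pi * (real (?r x) + real (?r y)) / real p)"
    unfolding E by (simp add: cis_mult ring_distribs add_divide_distrib)
  also have "2 * pi * (real (?r x) + real (?r y)) / real p
      = 2 * pi * real (?r (x + y)) / real p + 2 * pi * of_int k"
    unfolding k using p by (simp add: field_simps)
  also have "cis \<dots> = E (x + y)"
    unfolding E by (simp add: cis_mult[symmetric] cis_multiple_2pi)
  finally show ?thesis by simp
qed

text \<open>The representative of \<open>1\<close> is \<open>1\<close>, and \<open>exp (2 \<pi> \<i> / p) = 1\<close> would make \<open>1 / p\<close> an integer.\<close>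
lemma exp_prime_field_rep_1:
  assumes "CHAR('a :: finite_field) = p"
  shows "exp (2 * of_real pi * \<i> * of_nat (prime_field_rep p (1 :: 'a)) / of_nat p) \<noteq> (1 :: complex)"
proof
  assume *: "exp (2 * of_real pi * \<i> * of_nat (prime_field_rep p (1 :: 'a)) / of_nat p) = (1 :: complex)"
  have "prime p" using assms CHAR_prime by blast
  then have p: "p > 1" by (rule prime_gt_1_nat)
  let ?r = "prime_field_rep p (1 :: 'a)"
  have "?r < p" "(of_nat ?r :: 'a) = of_nat 1"
    using prime_field_rep[OF assms, of 1] by simp_all
  then have "[?r = 1] (mod p)"
    using of_nat_eq_iff_cong_CHAR[where 'a='a] assms by blast
  then have r: "?r = 1" using \<open>?r < p\<close> p by (simp add: cong_def)
  have "cis (2 * pi / real p) = 1"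
    using * unfolding r by (simp add: cis_conv_exp mult_ac)
  then have "cos (2 * pi / real p) = 1" by (metis cis.sel(1) one_complex.sel(1))
  then obtain k :: int where "2 * pi / real p = of_int k * 2 * pi"
    using cos_one_2pi_int by blast
  then have "1 = real_of_int (k * int p)" using p by (simp add: field_simps)
  then have "k * int p = 1" by linarith
  then have "int p dvd 1" by (metis dvd_triv_right)
  then show False using p by simp
qed

text \<open>For \<open>t = 1\<close> the prime field is all of \<open>F\<^sub>q\<close> by counting, and the identity takes the place of the first
  coordinate. The condition \<open>\<chi> 0 = 1\<close> is listed because the zero function, too, is
  multiplicative on sums and not constantly \<open>1\<close>.\<close>
lemma epsilon_character:
  fixes \<theta> :: "'a :: {finite_field, field_gcd}"
  assumes "prime p" "t \<ge> 1" "CARD('a) = p ^ t" "t > 1 \<Longrightarrow> presentation t \<theta> \<Psi>"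
  obtains \<chi> :: "'a \<Rightarrow> complex" where
    "\<And>h f. epsilon p t \<theta> h f = \<chi> (top_residue_coeff h f)"
    "\<chi> 0 = 1" "\<And>x y. \<chi> (x + y) = \<chi> x * \<chi> y" "\<exists>x. \<chi> x \<noteq> 1"
proof -
  have "CHAR('a) dvd p ^ t" using CHAR_dvd_card_UNIV[where 'a='a] assms(3) by simp
  then have char: "CHAR('a) = p"
    using assms(1) by (metis CHAR_prime prime_dvd_power primes_dvd_imp_eq)
  define c where "c = (\<lambda>\<alpha>. if t = 1 then \<alpha> else first_coord t \<theta> \<alpha>)"
  have c: "(\<forall>x. c x \<in> prime_field) \<and> (\<forall>x y. c (x + y) = c x + c y) \<and> (\<exists>x. c x = 1)"
  proof (cases "t = 1")
    case True
    then have "card (prime_field :: 'a set) = CARD('a)"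
      using assms(3) card_prime_field[where 'a='a] char by simp
    then have "(prime_field :: 'a set) = UNIV" by (intro card_subset_eq) auto
    then show ?thesis using True by (simp add: c_def)
  next
    case False
    then have pres: "presentation t \<theta> \<Psi>" using assms(2,4) by simp
    have card: "CARD('a) = CHAR('a) ^ t" using assms(3) char by simp
    show ?thesis
      using False first_coord_additive[OF pres assms(2) card] by (auto simp: c_def)
  qed
  define \<chi> where
    "\<chi> = (\<lambda>x. exp (2 * of_real pi * \<i> * of_nat (prime_field_rep p (c x)) / of_nat p) :: complex)"
  show ?thesis
  proof (rule that[of \<chi>])
    show "epsilon p t \<theta> h f = \<chi> (top_residue_coeff h f)" for h f
      by (simp add: epsilon_def \<chi>_def c_def Let_def)
    show add: "\<chi> (x + y) = \<chi> x * \<chi> y" for x y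
      using exp_prime_field_rep_add[OF char, of "c x" "c y"] c by (simp add: \<chi>_def)
    show "\<chi> 0 = 1" using add[of 0 0] by (simp add: \<chi>_def)
    show "\<exists>x. \<chi> x \<noteq> 1"
      using c exp_prime_field_rep_1[OF char] unfolding \<chi>_def by metis
  qed
qed

section \<open>Residue systems and orthogonality\<close>

lemma finite_card_coeffs_below:
  "finite {P :: 'a :: {finite, zero} poly. \<forall>i\<ge>n. coeff P i = 0} \<and>
   card {P :: 'a poly. \<forall>i\<ge>n. coeff P i = 0} = CARD('a) ^ n"
proof (induction n)
  case 0
  have "{P :: 'a poly. \<forall>i\<ge>0. coeff P i = 0} = {0}" by (auto simp: poly_eq_iff)
  then show ?case by simp
next
  case (Suc n)
  let ?B = "\<lambda>n. {P :: 'a poly. \<forall>i\<ge>n. coeff P i = 0}"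
  have "?B (Suc n) = (\<lambda>(a, P). pCons a P) ` (UNIV \<times> ?B n)"
  proof (intro equalityI subsetI)
    fix P :: "'a poly" assume P: "P \<in> ?B (Suc n)"
    obtain a Q where Q: "P = pCons a Q" by (cases P)
    have "coeff Q i = 0" if "i \<ge> n" for i
    proof -
      have "coeff P (Suc i) = 0" using P that by simp
      then show ?thesis by (simp add: Q)
    qed
    then show "P \<in> (\<lambda>(a, P). pCons a P) ` (UNIV \<times> ?B n)" using Q by force
  qed (auto simp: coeff_pCons split: nat.splits)
  moreover have "inj_on (\<lambda>(a, P). pCons a P) (UNIV \<times> ?B n)" by (auto simp: inj_on_def)
  ultimately show ?case using Suc by (simp add: card_image card_cartesian_product)
qed

text \<open>The set of all remainders modulo \<open>f\<close> serves as the standard residue system.\<close>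
lemma range_mod_poly:
  fixes f :: "'a :: field_gcd poly"
  assumes "f \<noteq> 0"
  shows "range (\<lambda>g. g mod f) = {P. \<forall>i\<ge>degree f. coeff P i = 0}"
proof (intro equalityI subsetI)
  fix P :: "'a poly" assume "P \<in> range (\<lambda>g. g mod f)"
  then obtain g where "P = g mod f" by blast
  then have "P = 0 \<or> degree P < degree f" using assms degree_mod_less by blast
  then show "P \<in> {P. \<forall>i\<ge>degree f. coeff P i = 0}" by (auto simp: coeff_eq_0)
next
  fix P :: "'a poly" assume "P \<in> {P. \<forall>i\<ge>degree f. coeff P i = 0}"
  then have "lead_coeff P = 0 \<or> degree P < degree f" by (cases "degree P < degree f") auto
  then have "P mod f = P" by (auto simp: mod_poly_less)
  then show "P \<in> range (\<lambda>g. g mod f)" by (metis rangeI)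
qed

lemma finite_range_mod_poly:
  "f \<noteq> 0 \<Longrightarrow> finite (range (\<lambda>g. g mod f))"
  and card_range_mod_poly:
  "f \<noteq> 0 \<Longrightarrow> card (range (\<lambda>g. g mod f)) = poly_abs f" for f :: "'a :: {finite_field, field_gcd} poly"
  using finite_card_coeffs_below[where 'a='a] by (simp_all add: range_mod_poly poly_abs_def)

lemma sum_complete_residue_system:
  fixes f :: "'a :: field_gcd poly"
  assumes "complete_residue_system f R" and "\<And>g. F (g mod f) = F g"
  shows "sum F R = sum F (range (\<lambda>g. g mod f))"
proof -
  have R: "\<exists>!r. r \<in> R \<and> [r = g] (mod f)" for g
    using assms(1) by (simp add: complete_residue_system_def)
  have "bij_betw (\<lambda>g. g mod f) R (range (\<lambda>g. g mod f))"
    unfolding bij_betw_def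
  proof
    show "inj_on (\<lambda>g. g mod f) R"
      using R by (intro inj_onI) (metis cong_def)
    show "(\<lambda>g. g mod f) ` R = range (\<lambda>g. g mod f)"
      using R by (auto simp: cong_def image_iff) metis
  qed
  from sum.reindex_bij_betw[OF this, of F] show ?thesis
    by (simp add: assms(2))
qed

text \<open>Translating the summation variable by an element on which \<open>\<psi>\<close> differs from \<open>1\<close>
  permutes the residues and also multiplies the sum by that value, so the sum vanishes.\<close>
lemma sum_character_mod:
  fixes n :: "'a :: {finite_field, field_gcd} poly" and \<psi> :: "'a poly \<Rightarrow> complex"
  assumes "n \<noteq> 0" and add: "\<And>x y. \<psi> (x + y) = \<psi> x * \<psi> y" and one: "\<And>k. \<psi> (n * k) = 1"
  shows "(\<Sum>k\<in>range (\<lambda>g. g mod n). \<psi> k) = (if \<forall>k. \<psi> k = 1 then of_nat (poly_abs n) else 0)"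
proof (cases "\<forall>k. \<psi> k = 1")
  case True
  then show ?thesis using card_range_mod_poly[OF assms(1)] by simp
next
  case False
  then obtain a where a: "\<psi> a \<noteq> 1" by blast
  have per: "\<psi> (g mod n) = \<psi> g" for g
    using add[of "n * (g div n)" "g mod n"] one[of "g div n"] by simp
  let ?M = "range (\<lambda>g. g mod n)"
  have "(\<Sum>k\<in>?M. \<psi> k) = (\<Sum>k\<in>?M. \<psi> (k + a))"
  proof (rule sum.reindex_bij_witness[where i = "\<lambda>k. (k + a) mod n" and j = "\<lambda>k. (k - a) mod n"])
    fix k assume k: "k \<in> ?M"
    then have kn: "k mod n = k" by auto
    show "((k - a) mod n + a) mod n = k" "((k + a) mod n - a) mod n = k"
      using kn by (simp_all add: mod_simps)
    show "\<psi> ((k - a) mod n + a) = \<psi> k"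
      using per[of "k - a"] add[of "k - a" a] add[of "(k - a) mod n" a] by simp
  qed auto
  also have "\<dots> = (\<Sum>k\<in>?M. \<psi> k) * \<psi> a" by (simp add: add sum_distrib_right)
  finally have "(\<Sum>k\<in>?M. \<psi> k) = 0" using a by (metis mult_cancel_left1)
  then show ?thesis using False by (simp only: if_False)
qed

text \<open>If \<open>f\<close> does not divide \<open>m\<close>, the nonzero remainder of \<open>m\<close> can be shifted by a power of \<open>X\<close> so that
  its leading coefficient lands at the position read off by \<^const>\<open>top_residue_coeff\<close>; a scalar then
  gives it any value.\<close>
lemma top_residue_coeff_surj:
  fixes f m :: "'a :: field_gcd poly"
  assumes "f \<noteq> 0" "\<not> f dvd m"
  shows "\<exists>k. top_residue_coeff (m * k) f = x"
proof -
  define r where "r = m mod f"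
  have "r \<noteq> 0" using assms by (auto simp: r_def dvd_eq_mod_eq_0)
  then have deg: "degree r < degree f"
    using assms(1) unfolding r_def by (rule degree_mod_less'[rotated])
  define k where "k = monom (x / lead_coeff r) (degree f - 1 - degree r)"
  have "degree (r * k) \<le> degree r + (degree f - 1 - degree r)"
    by (rule order.trans[OF degree_mult_le]) (simp add: k_def degree_monom_le)
  then have "degree (r * k) < degree f" using deg by simp
  then have "r * k mod f = r * k" by (rule mod_poly_less)
  moreover have "m * k mod f = r * k mod f" by (simp add: r_def mod_simps)
  moreover have "coeff (r * k) (degree f - 1) = x"
    using deg \<open>r \<noteq> 0\<close> by (simp add: k_def mult.commute[of r] coeff_monom_mult)
  ultimately show ?thesis unfolding top_residue_coeff_def by metis
qed

lemma top_residue_coeff_mod: "top_residue_coeff (h * (g mod f)) f = top_residue_coeff (h * g) f"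
  for f :: "'a :: field_gcd poly"
  by (simp add: top_residue_coeff_def mod_simps)

lemma top_residue_coeff_add:
  "top_residue_coeff (g + h) f = top_residue_coeff g f + top_residue_coeff h f"
  for f :: "'a :: field_gcd poly"
  by (simp add: top_residue_coeff_def poly_mod_add_left)

lemma poly_abs_mult:
  "f \<noteq> 0 \<Longrightarrow> g \<noteq> 0 \<Longrightarrow> poly_abs (f * g) = poly_abs f * poly_abs g"
  by (simp add: poly_abs_def degree_mult_eq power_add)

text \<open>The multiples of \<open>d\<close> modulo \<open>f = d e\<close> are the \<open>d k\<close> with \<open>k\<close> modulo \<open>e\<close>, and
  \<open>\<chi>\<close> applied to the top coefficient of \<open>h d k mod f\<close> is an additive character in \<open>k\<close> modulo \<open>e\<close>,
  trivial exactly when \<open>e\<close> divides \<open>h\<close>.\<close>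
lemma sum_character_multiples:
  fixes h d e :: "'a :: {finite_field, field_gcd} poly" and \<chi> :: "'a \<Rightarrow> complex"
  assumes "d \<noteq> 0" "e \<noteq> 0"
    and \<chi>: "\<chi> 0 = 1" "\<And>x y. \<chi> (x + y) = \<chi> x * \<chi> y" "\<exists>x. \<chi> x \<noteq> 1"
  shows "(\<Sum>g | g \<in> range (\<lambda>g. g mod (d * e)) \<and> d dvd g. \<chi> (top_residue_coeff (h * g) (d * e)))
    = (if e dvd h then of_nat (poly_abs e) else 0)"
proof -
  let ?\<tau> = "\<lambda>g. top_residue_coeff (h * g) (d * e)"
  let ?\<psi> = "\<lambda>k. \<chi> (?\<tau> (d * k))"
  let ?M = "range (\<lambda>g. g mod e)"
  have "{g. g \<in> range (\<lambda>g. g mod (d * e)) \<and> d dvd g} = (*) d ` ?M"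
  proof (intro equalityI subsetI)
    fix g assume "g \<in> {g. g \<in> range (\<lambda>g. g mod (d * e)) \<and> d dvd g}"
    then have g: "d dvd g" "g mod (d * e) = g" by auto
    then obtain k where k: "g = d * k" by blast
    have "d * (k mod e) = d * k mod (d * e)" by (rule mult_mod_right)
    also have "\<dots> = g" unfolding k[symmetric] by (rule g)
    finally have "g = d * (k mod e)" by (rule sym)
    then show "g \<in> (*) d ` ?M" by blast
  next
    fix g assume "g \<in> (*) d ` ?M"
    then obtain k where "g = d * (k mod e)" by blast
    then have "g = d * k mod (d * e)" "d dvd g" by simp_all
    then show "g \<in> {g. g \<in> range (\<lambda>g. g mod (d * e)) \<and> d dvd g}" by blast
  qed
  moreover have "inj_on ((*) d) ?M" using assms(1) by (simp add: inj_on_def)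
  ultimately have "(\<Sum>g | g \<in> range (\<lambda>g. g mod (d * e)) \<and> d dvd g. \<chi> (?\<tau> g)) = (\<Sum>k\<in>?M. ?\<psi> k)"
    by (simp add: sum.reindex)
  also have "\<dots> = (if \<forall>k. ?\<psi> k = 1 then of_nat (poly_abs e) else 0)"
  proof (rule sum_character_mod[OF assms(2)])
    show "?\<psi> (x + y) = ?\<psi> x * ?\<psi> y" for x y
      by (simp add: distrib_left top_residue_coeff_add \<chi>(2))
    show "?\<psi> (e * k) = 1" for k
    proof -
      have "h * (d * (e * k)) = d * e * (h * k)" by (simp add: mult_ac)
      then have "h * (d * (e * k)) mod (d * e) = 0" by (simp only: mod_mult_self1_is_0)
      then show ?thesis by (simp add: top_residue_coeff_def \<chi>(1))
    qed
  qed
  also have "(\<forall>k. ?\<psi> k = 1) \<longleftrightarrow> e dvd h"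
  proof
    assume "e dvd h"
    then obtain c where "h = e * c" by blast
    then have "h * (d * k) = d * e * (c * k)" for k by (simp add: mult_ac)
    then have "h * (d * k) mod (d * e) = 0" for k by (simp only: mod_mult_self1_is_0)
    then show "\<forall>k. ?\<psi> k = 1" by (simp only: top_residue_coeff_def coeff_0 \<chi>(1) simp_thms)
  next
    assume *: "\<forall>k. ?\<psi> k = 1"
    show "e dvd h"
    proof (rule ccontr)
      assume "\<not> e dvd h"
      then have "\<not> d * e dvd h * d" using assms(1) by (simp add: mult.commute[of h])
      then have "\<exists>k. top_residue_coeff (h * d * k) (d * e) = x" for x
        using assms by (intro top_residue_coeff_surj) auto
      then show False using * \<chi>(3) by (metis mult.assoc)
    qed
  qed
  finally show ?thesis .
qed

section \<open>Divisor sums\<close>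

lemma finite_monic_divisors:
  fixes f :: "'a :: {finite_field, field_gcd} poly"
  assumes "f \<noteq> 0"
  shows "finite (monic_divisors f)"
proof (rule finite_subset)
  show "monic_divisors f \<subseteq> {P. \<forall>i\<ge>Suc (degree f). coeff P i = 0}"
    using assms by (auto simp: monic_divisors_def dest!: dvd_imp_degree_le intro!: coeff_eq_0)
  show "finite {P :: 'a poly. \<forall>i\<ge>Suc (degree f). coeff P i = 0}"
    using finite_card_coeffs_below by blast
qed

lemma monic_divisors_gcd: "monic_divisors (gcd f g) = {d \<in> monic_divisors f. d dvd g}"
  by (auto simp: monic_divisors_def)

lemma monic_div:
  fixes f d :: "'a :: field_gcd poly"
  assumes "lead_coeff f = 1" "lead_coeff d = 1" "d dvd f"
  shows "lead_coeff (f div d) = 1"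
  using assms by (metis dvd_mult_div_cancel lead_coeff_mult mult_1)

lemma div_mem_monic_divisors:
  fixes f d :: "'a :: field_gcd poly"
  assumes "lead_coeff f = 1" "d \<in> monic_divisors f"
  shows "f div d \<in> monic_divisors f" "f div (f div d) = d"
  using assms monic_div[of f d] by (auto simp: monic_divisors_def elim!: dvdE)

text \<open>The class axioms of \<open>field_gcd\<close> leave \<^const>\<open>unit_factor\<close> on the field abstract, but they make it the
  identity on units, that is, on all nonzero scalars.\<close>
lemma lead_coeff_normalize:
  fixes f :: "'a :: field_gcd poly"
  assumes "f \<noteq> 0"
  shows "lead_coeff (normalize f) = 1"
proof -
  define c where "c = lead_coeff (normalize f)"
  have "[:unit_factor c:] = 1"
    using unit_factor_normalize[OF assms] by (simp only: unit_factor_poly_def c_def)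
  then have "unit_factor c = 1" by (simp add: one_pCons)
  moreover have "c dvd 1" using assms by (simp add: c_def dvd_field_iff del: coeff_normalize)
  then have "unit_factor c = c" by (rule is_unit_unit_factor)
  ultimately show ?thesis by (simp add: c_def)
qed

lemma a_coeff_mod: "a_coeff G H f (g mod f) = a_coeff G H f g"
  by (cases "f = 0") (simp_all add: a_coeff_def)

text \<open>Exchanging the two summations leaves for each \<open>d\<close> dividing \<open>f\<close> a sum of the character over
  the multiples of \<open>d\<close>, which is \<open>|f / d|\<close> or \<open>0\<close> according to whether \<open>f / d\<close> divides \<open>h\<close>; the
  surviving terms are those of \<open>S(h; f)\<close>, listed by the complementary divisor.\<close>
lemma S_sum_eq_character_sum:
  fixes h f :: "'a :: {finite_field, field_gcd} poly" and \<chi> :: "'a \<Rightarrow> complex"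
  assumes f: "lead_coeff f = 1"
    and \<chi>: "\<chi> 0 = 1" "\<And>x y. \<chi> (x + y) = \<chi> x * \<chi> y" "\<exists>x. \<chi> x \<noteq> 1"
  shows "(\<Sum>g\<in>range (\<lambda>g. g mod f). a_coeff G H f g * \<chi> (top_residue_coeff (h * g) f)) = S_sum G H h f"
proof -
  let ?M = "range (\<lambda>g. g mod f)" and ?\<tau> = "\<lambda>g. top_residue_coeff (h * g) f"
  define w where "w = (\<lambda>d. of_nat (poly_abs d) * H d * G (f div d))"
  have f0: "f \<noteq> 0" using f by auto
  have pos: "poly_abs f \<noteq> 0" by (simp add: poly_abs_def)
  note fin = finite_range_mod_poly[OF f0] finite_monic_divisors[OF f0]
  have "(\<Sum>g\<in>?M. a_coeff G H f g * \<chi> (?\<tau> g))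
      = 1 / of_nat (poly_abs f) * (\<Sum>g\<in>?M. \<Sum>d | d \<in> monic_divisors f \<and> d dvd g. w d * \<chi> (?\<tau> g))"
    by (simp add: a_coeff_def monic_divisors_gcd w_def sum_distrib_left sum_distrib_right sum_divide_distrib)
  also have "\<dots> = 1 / of_nat (poly_abs f) *
      (\<Sum>d\<in>monic_divisors f. w d * (\<Sum>g | g \<in> ?M \<and> d dvd g. \<chi> (?\<tau> g)))"
    by (subst sum.swap_restrict[OF fin]) (simp add: sum_distrib_left)
  also have "\<dots> = (\<Sum>d\<in>monic_divisors f. if f div d dvd h then H d * G (f div d) else 0)"
  proof (subst sum_distrib_left, intro sum.cong refl)
    fix d assume "d \<in> monic_divisors f"
    then obtain e where e: "f = d * e" by (auto simp: monic_divisors_def)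
    then have de: "d \<noteq> 0" "e \<noteq> 0" "f div d = e" using f0 by auto
    show "1 / of_nat (poly_abs f) * (w d * (\<Sum>g | g \<in> ?M \<and> d dvd g. \<chi> (?\<tau> g)))
        = (if f div d dvd h then H d * G (f div d) else 0)"
      using sum_character_multiples[of d e, OF de(1,2) \<chi>, of h] pos
      by (simp add: e[symmetric] de(3) w_def) (simp add: e poly_abs_mult de)
  qed
  also have "\<dots> = (\<Sum>d | d \<in> monic_divisors f \<and> f div d dvd h. H d * G (f div d))"
    using fin(2) by (simp add: sum.inter_filter)
  also have "\<dots> = (\<Sum>d\<in>monic_divisors (gcd h f). G d * H (f div d))"
    unfolding gcd.commute[of h f] monic_divisors_gcd
    by (rule sum.reindex_bij_witness[where i = "\<lambda>d. f div d" and j = "\<lambda>d. f div d"])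
      (auto simp: div_mem_monic_divisors[OF f])
  finally show ?thesis by (simp add: S_sum_def)
qed

text \<open>For \<open>d\<close> dividing \<open>r\<close>, the quotient \<open>f / d\<close> is the product of the monic polynomials \<open>f / r\<close> and
  \<open>r / d\<close>, so complete multiplicativity pulls out \<open>G (f / r)\<close>.\<close>
lemma a_coeff_completely_multiplicative:
  fixes f g :: "'a :: {finite_field, field_gcd} poly"
  assumes G: "completely_multiplicative G" and f: "lead_coeff f = 1" and r: "r = gcd g f"
  shows "a_coeff G H f g = 1 / of_nat (poly_abs f) * G (f div r) *
    (\<Sum>d\<in>monic_divisors r. of_nat (poly_abs d) * H d * G (r div d))"
proof -
  have "f \<noteq> 0" using f by auto
  then have r0: "r \<noteq> 0" by (simp add: r)
  have r1: "lead_coeff r = 1" using lead_coeff_normalize[OF r0] by (simp add: r)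
  have rf: "r dvd f" by (simp add: r)
  have "G (f div d) = G (f div r) * G (r div d)" if "d \<in> monic_divisors r" for d
  proof -
    have d: "lead_coeff d = 1" "d dvd r" using that by (auto simp: monic_divisors_def)
    then have "f div d = (f div r) * (r div d)"
      using rf r0 by (auto elim!: dvdE)
    then show ?thesis
      using G monic_div[OF f r1 rf] monic_div[OF r1 d] by (simp add: completely_multiplicative_def)
  qed
  then show ?thesis
    by (simp add: a_coeff_def gcd.commute[of f g] r[symmetric] sum_distrib_left mult_ac cong: sum.cong)
qed

theorem theorem3p2:
  fixes p t :: nat
    and \<theta> :: "'a :: {finite_field, field_gcd}"
    and \<Psi> :: "'a poly"
    and G H :: "'a poly \<Rightarrow> complex"
  assumes "prime p" and "t \<ge> 1" and "CARD('a) = p ^ t"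
    and "t > 1 \<Longrightarrow> presentation t \<theta> \<Psi>"
  shows "(\<forall>h f R. lead_coeff h = 1 \<longrightarrow> lead_coeff f = 1 \<longrightarrow> complete_residue_system f R \<longrightarrow>
            S_sum G H h f = (\<Sum>g\<in>R. a_coeff G H f g * epsilon p t \<theta> (h * g) f)) \<and>
         (completely_multiplicative G \<longrightarrow>
            (\<forall>f g r. lead_coeff f = 1 \<longrightarrow> r = gcd g f \<longrightarrow>
               a_coeff G H f g = 1 / of_nat (poly_abs f) * G (f div r) *
                 (\<Sum>d\<in>monic_divisors r. of_nat (poly_abs d) * H d * G (r div d))))"
proof (intro conjI allI impI)
  fix h f :: "'a poly" and R assume f: "lead_coeff f = 1" and R: "complete_residue_system f R"
  obtain \<chi> :: "'a \<Rightarrow> complex" where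
    eps: "\<And>h f. epsilon p t \<theta> h f = \<chi> (top_residue_coeff h f)" and
    \<chi>: "\<chi> 0 = 1" "\<And>x y. \<chi> (x + y) = \<chi> x * \<chi> y" "\<exists>x. \<chi> x \<noteq> 1"
    using epsilon_character[OF assms] by metis
  have "(\<Sum>g\<in>R. a_coeff G H f g * epsilon p t \<theta> (h * g) f)
      = (\<Sum>g\<in>range (\<lambda>g. g mod f). a_coeff G H f g * epsilon p t \<theta> (h * g) f)"
    by (rule sum_complete_residue_system[OF R]) (simp add: a_coeff_mod eps top_residue_coeff_mod)
  then show "S_sum G H h f = (\<Sum>g\<in>R. a_coeff G H f g * epsilon p t \<theta> (h * g) f)"
    using S_sum_eq_character_sum[OF f \<chi>] by (simp add: eps)
qed (rule a_coeff_completely_multiplicative)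

end
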